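(* Let $\kappa\in\mathcal K\setminus\{0\}$ and let $\alpha:\mathcal X\to\bar L^0$ be a $\kappa$-sensitive and $\kappa$-bounded upper semicontinuous conditional assessment index. Define $$C(X):=\operatorname{ess\,inf}\{m\in L^0:\alpha(m\kappa)\ge\alpha(X)\},\qquad X\in\mathcal X.$$ Then $C$ is a $\kappa$-conditional certainty equivalent of $\alpha$, and $$\alpha(X)\ge\alpha(Y)\iff C(X)\ge C(Y),\qquad X,Y\in\mathcal X.$$ In this case $C$ is itself a $\kappa$-sensitive and $\kappa$-bounded conditional assessment index. If in addition $\alpha$ is $\kappa$-strictly increasing, then $C$ is upper semicontinuous, and it is the unique $\kappa$-conditional certainty equivalent of $\alpha$.
   Context: Let $(\Omega,\mathscr G,P)$ be a probability space. $L^0$ and $\bar L^0$ are the spaces of $\mathscr G$-measurable random variables with values in $(-\infty,\infty)$ and $[-\infty,\infty]$, identified when $P$-a.s. equal; (in)equalities are $P$-a.s. (so $n<m$ means $P[n<m]=1$; "on $A$" means a.s. on $A$). $L^0_+=\{m\in L^0:m\ge0\}$, $L^0_{++}=\{m\in L^0: m>0\}$. $L^0$ carries the topology induced by the balls $B_\varepsilon(m)=\{n\in L^0:|m-n|\le\varepsilon\}$, $\varepsilon\in L^0_{++}$. $\mathcal X$ is a locally $L^0$-convex topological $L^0$-module: an $L^0$-module with a topology making addition and scalar multiplication continuous and having a neighborhood base of $0$ of sets $U$ that are $L^0$-convex ($\lambda X+(1-\lambda)Y\in U$ for $X,Y\in U$, $\lambda\in L^0$, $0\le\lambda\le1$), $L^0$-absorbent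 (for every $X$ there is $\lambda\in L^0_{++}$ with $X\in\lambda U$) and $L^0$-balanced ($\lambda X\in U$ for $X\in U$, $\lambda\in L^0$, $|\lambda|\le1$). It is assumed that $\mathcal X$ is $\sigma$-stable: for every countable measurable partition $(A_i)$ of $\Omega$ and $(X_i)\subseteq\mathcal X$ there is a unique element $\sum1_{A_i}X_i\in\mathcal X$ with $1_{A_j}\sum_i1_{A_i}X_i=1_{A_j}X_j$ for all $j$; and that the set of neighborhoods of $0$ is $\sigma$-stable (closed under $(U_i)\mapsto\sum1_{A_i}U_i$). $\mathcal K\subseteq\mathcal X$ is a closed $L^0$-convex cone ($\lambda X\in\mathcal K$ for $\lambda\in L^0_{++}$, $X\in\mathcal K$) containing $0$; $X\succcurlyeq Y$ means $X-Y\in\mathcal K$. A conditional assessment index is a function $\alpha:\mathcal X\to\bar L^0$ that is local ($\alpha(1_AX+1_{A^c}Y)=1_A\alpha(X)+1_{A^c}\alpha(Y)$, $A\in\mathscr G$), quasiconcave ($\alpha(\lambda X+(1-\lambda)Y)\ge\alpha(X)\wedge\alpha(Y)$ for $\lambda\in L^0$, $0\le\lambda\le1$) and monotone ($\alpha(X)\ge\alpha(Y)$ if $X\succcurlyeq Y$). Upper semicontinuous: $\{X:\alpha(X)\ge m\}$ is closed for all $m\in\bar L^0$. A $\kappa$-conditional certainty equivalent of $\alpha$ is a local functional $C:\mathcal X\to L^0$ with $\alpha(C(X)\kappa)=\alpha(X)$ for all $X\in\mathcal X$. A conditional assessment index $\alpha$ is: - $\kappa$-bounded if for any $X\in\mathcal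 X$ there exist $m_1,m_2\in L^0$ with $\alpha(m_1\kappa)<\alpha(X)\le\alpha(m_2\kappa)$; - $\kappa$-strictly increasing if $\alpha(m\kappa)>\alpha(m'\kappa)$ on $A$ whenever $m,m'\in L^0$ and $m>m'$ on $A$; - $\kappa$-sensitive if for $m\in L^0$ and $Y\in\mathcal X$ with $\alpha(m\kappa)>\alpha(Y)$ on some $A\in\mathscr G$, there exists $\varepsilon\in L^0_+$ with $\varepsilon>0$ on $A$ such that $\alpha((m-\varepsilon)\kappa)\ge\alpha(Y)$ on $A$. *)

theory Defs
  imports "HOL-Probability.Probability"
begin

text \<open>
  Elements of \<open>L\<^sup>0\<close> and of its extended version are represented by measurable functions, and
  equality and order between them are always understood almost surely. Hence operations taking
  such a function as an argument are required to respect almost sure equality.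
\<close>

abbreviation L0 :: "'a measure \<Rightarrow> ('a \<Rightarrow> real) set"
  where "L0 M \<equiv> borel_measurable M"

abbreviation L0_ext :: "'a measure \<Rightarrow> ('a \<Rightarrow> ereal) set"
  where "L0_ext M \<equiv> borel_measurable M"

definition L0_nonneg :: "'a measure \<Rightarrow> ('a \<Rightarrow> real) set"
  where "L0_nonneg M = {m \<in> L0 M. AE \<omega> in M. 0 \<le> m \<omega>}"

definition L0_pos :: "'a measure \<Rightarrow> ('a \<Rightarrow> real) set"
  where "L0_pos M = {m \<in> L0 M. AE \<omega> in M. 0 < m \<omega>}"

definition L0_unit :: "'a measure \<Rightarrow> ('a \<Rightarrow> real) set"
  where "L0_unit M = {l \<in> L0 M. AE \<omega> in M. 0 \<le> l \<omega> \<and> l \<omega> \<le> 1}"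

definition L0_ball :: "'a measure \<Rightarrow> ('a \<Rightarrow> real) \<Rightarrow> ('a \<Rightarrow> real) \<Rightarrow> ('a \<Rightarrow> real) set"
  where "L0_ball M m e = {n \<in> L0 M. AE \<omega> in M. \<bar>m \<omega> - n \<omega>\<bar> \<le> e \<omega>}"

definition L0_topology :: "'a measure \<Rightarrow> ('a \<Rightarrow> real) topology"
  where "L0_topology M =
    topology (\<lambda>U. U \<subseteq> L0 M \<and> (\<forall>m\<in>U. \<exists>e\<in>L0_pos M. L0_ball M m e \<subseteq> U))"

lemma openin_L0_topology:
  "openin (L0_topology M) U \<longleftrightarrow>
    U \<subseteq> L0 M \<and> (\<forall>m\<in>U. \<exists>e\<in>L0_pos M. L0_ball M m e \<subseteq> U)"
proof -
  let ?P = "\<lambda>U. U \<subseteq> L0 M \<and> (\<forall>m\<in>U. \<exists>e\<in>L0_pos M. L0_ball M m e \<subseteq> U)"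
  have "istopology ?P"
    unfolding istopology_def
  proof (intro conjI allI impI)
    fix S T assume S: "?P S" and T: "?P T"
    show "S \<inter> T \<subseteq> L0 M" using S by blast
    show "\<forall>m\<in>S \<inter> T. \<exists>e\<in>L0_pos M. L0_ball M m e \<subseteq> S \<inter> T"
    proof
      fix m assume m: "m \<in> S \<inter> T"
      then obtain d e where d: "d \<in> L0_pos M" "L0_ball M m d \<subseteq> S"
        and e: "e \<in> L0_pos M" "L0_ball M m e \<subseteq> T"
        using S T by blast
      have "(\<lambda>\<omega>. min (d \<omega>) (e \<omega>)) \<in> L0_pos M"
        using d(1) e(1) unfolding L0_pos_def by auto
      moreover have "L0_ball M m (\<lambda>\<omega>. min (d \<omega>) (e \<omega>)) \<subseteq> L0_ball M m d \<inter> L0_ball M m e"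
        unfolding L0_ball_def by auto
      ultimately show "\<exists>e\<in>L0_pos M. L0_ball M m e \<subseteq> S \<inter> T"
        using d(2) e(2) by blast
    qed
  next
    fix \<K> assume K: "\<forall>S\<in>\<K>. ?P S"
    show "\<Union>\<K> \<subseteq> L0 M" using K by blast
    show "\<forall>m\<in>\<Union>\<K>. \<exists>e\<in>L0_pos M. L0_ball M m e \<subseteq> \<Union>\<K>"
      using K by (meson Union_iff Union_upper subset_trans)
  qed
  then show ?thesis
    unfolding L0_topology_def by (simp add: topology_inverse')
qed

locale L0_module = prob_space M
  for M :: "'a measure" +
  fixes act :: "('a \<Rightarrow> real) \<Rightarrow> 'x::ab_group_add \<Rightarrow> 'x"
  assumes act_cong_AE:
      "\<lbrakk>f \<in> L0 M; g \<in> L0 M; AE \<omega> in M. f \<omega> = g \<omega>\<rbrakk> \<Longrightarrow> act f X = act g X"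
    and act_add_right: "f \<in> L0 M \<Longrightarrow> act f (X + Y) = act f X + act f Y"
    and act_add_left:
      "\<lbrakk>f \<in> L0 M; g \<in> L0 M\<rbrakk> \<Longrightarrow> act (\<lambda>\<omega>. f \<omega> + g \<omega>) X = act f X + act g X"
    and act_act:
      "\<lbrakk>f \<in> L0 M; g \<in> L0 M\<rbrakk> \<Longrightarrow> act (\<lambda>\<omega>. f \<omega> * g \<omega>) X = act f (act g X)"
    and act_one: "act (\<lambda>\<omega>. 1) X = X"

definition L0_convex :: "'a measure \<Rightarrow> (('a \<Rightarrow> real) \<Rightarrow> 'x \<Rightarrow> 'x::ab_group_add) \<Rightarrow> 'x set \<Rightarrow> bool"
  where "L0_convex M act U \<longleftrightarrow>
    (\<forall>X\<in>U. \<forall>Y\<in>U. \<forall>l\<in>L0_unit M. act l X + act (\<lambda>\<omega>. 1 - l \<omega>) Y \<in> U)"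

definition L0_absorbent :: "'a measure \<Rightarrow> (('a \<Rightarrow> real) \<Rightarrow> 'x \<Rightarrow> 'x) \<Rightarrow> 'x set \<Rightarrow> bool"
  where "L0_absorbent M act U \<longleftrightarrow> (\<forall>X. \<exists>l\<in>L0_pos M. X \<in> act l ` U)"

definition L0_balanced :: "'a measure \<Rightarrow> (('a \<Rightarrow> real) \<Rightarrow> 'x \<Rightarrow> 'x) \<Rightarrow> 'x set \<Rightarrow> bool"
  where "L0_balanced M act U \<longleftrightarrow>
    (\<forall>X\<in>U. \<forall>l\<in>L0 M. (AE \<omega> in M. \<bar>l \<omega>\<bar> \<le> 1) \<longrightarrow> act l X \<in> U)"

definition nbhd0 :: "'x::{topological_space, zero} set \<Rightarrow> bool"
  where "nbhd0 U \<longleftrightarrow> (\<exists>V. open V \<and> 0 \<in> V \<and> V \<subseteq> U)"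

text \<open>
  Continuity of addition is part of the class \<open>topological_ab_group_add\<close>; continuity of
  \<open>uminus\<close>, also part of it, is no restriction, being scalar multiplication by \<open>-1\<close>.
\<close>

locale locally_L0_convex_module = L0_module M act
  for M :: "'a measure" and act :: "('a \<Rightarrow> real) \<Rightarrow> 'x::topological_ab_group_add \<Rightarrow> 'x" +
  assumes continuous_act:
      "continuous_map (prod_topology (L0_topology M) euclidean) euclidean (\<lambda>(f, X). act f X)"
    and nbhd0_base:
      "nbhd0 N \<Longrightarrow> \<exists>U\<subseteq>N. nbhd0 U \<and> L0_convex M act U \<and> L0_absorbent M act U
                              \<and> L0_balanced M act U"

text \<open>Finite partitions are covered since members of the sequence may be empty.\<close>

definition countable_partition :: "'a measure \<Rightarrow> (nat \<Rightarrow> 'a set) \<Rightarrow> bool"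
  where "countable_partition M A \<longleftrightarrow>
    range A \<subseteq> sets M \<and> disjoint_family A \<and> (\<Union>i. A i) = space M"

definition is_gluing ::
    "(('a \<Rightarrow> real) \<Rightarrow> 'x \<Rightarrow> 'x) \<Rightarrow> (nat \<Rightarrow> 'a set) \<Rightarrow> (nat \<Rightarrow> 'x) \<Rightarrow> 'x \<Rightarrow> bool"
  where "is_gluing act A X Z \<longleftrightarrow>
    (\<forall>j. act (indicator (A j)) Z = act (indicator (A j)) (X j))"

definition sigma_stable :: "'a measure \<Rightarrow> (('a \<Rightarrow> real) \<Rightarrow> 'x \<Rightarrow> 'x) \<Rightarrow> bool"
  where "sigma_stable M act \<longleftrightarrow>
    (\<forall>A X. countable_partition M A \<longrightarrow> (\<exists>!Z. is_gluing act A X Z))"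

definition nbhds0_sigma_stable ::
    "'a measure \<Rightarrow> (('a \<Rightarrow> real) \<Rightarrow> 'x \<Rightarrow> 'x::{topological_space, zero}) \<Rightarrow> bool"
  where "nbhds0_sigma_stable M act \<longleftrightarrow>
    (\<forall>A U. countable_partition M A \<and> (\<forall>i. nbhd0 (U i)) \<longrightarrow>
      nbhd0 {Z. \<exists>X. (\<forall>i. X i \<in> U i) \<and> is_gluing act A X Z})"

definition L0_cone :: "'a measure \<Rightarrow> (('a \<Rightarrow> real) \<Rightarrow> 'x \<Rightarrow> 'x) \<Rightarrow> 'x set \<Rightarrow> bool"
  where "L0_cone M act K \<longleftrightarrow> (\<forall>l\<in>L0_pos M. \<forall>X\<in>K. act l X \<in> K)"

text \<open>In \<open>ereal\<close> we have \<open>0 * \<infinity> = 0\<close>, so multiplying by an indicator is restriction to the set.\<close>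

definition L0_local ::
    "'a measure \<Rightarrow> (('a \<Rightarrow> real) \<Rightarrow> 'x \<Rightarrow> 'x::ab_group_add) \<Rightarrow> ('x \<Rightarrow> 'a \<Rightarrow> ereal) \<Rightarrow> bool"
  where "L0_local M act \<alpha> \<longleftrightarrow>
    (\<forall>X Y. \<forall>A\<in>sets M. AE \<omega> in M.
      \<alpha> (act (indicator A) X + act (indicator (space M - A)) Y) \<omega>
        = indicator A \<omega> * \<alpha> X \<omega> + indicator (space M - A) \<omega> * \<alpha> Y \<omega>)"

definition L0_quasiconcave ::
    "'a measure \<Rightarrow> (('a \<Rightarrow> real) \<Rightarrow> 'x \<Rightarrow> 'x::ab_group_add) \<Rightarrow> ('x \<Rightarrow> 'a \<Rightarrow> ereal) \<Rightarrow> bool"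
  where "L0_quasiconcave M act \<alpha> \<longleftrightarrow>
    (\<forall>X Y. \<forall>l\<in>L0_unit M. AE \<omega> in M.
      min (\<alpha> X \<omega>) (\<alpha> Y \<omega>) \<le> \<alpha> (act l X + act (\<lambda>\<omega>. 1 - l \<omega>) Y) \<omega>)"

definition cone_monotone ::
    "'a measure \<Rightarrow> 'x::ab_group_add set \<Rightarrow> ('x \<Rightarrow> 'a \<Rightarrow> ereal) \<Rightarrow> bool"
  where "cone_monotone M K \<alpha> \<longleftrightarrow> (\<forall>X Y. X - Y \<in> K \<longrightarrow> (AE \<omega> in M. \<alpha> Y \<omega> \<le> \<alpha> X \<omega>))"

definition conditional_assessment_index ::
    "'a measure \<Rightarrow> (('a \<Rightarrow> real) \<Rightarrow> 'x \<Rightarrow> 'x::ab_group_add) \<Rightarrow> 'x set \<Rightarrow> ('x \<Rightarrow> 'a \<Rightarrow> ereal) \<Rightarrow> bool"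
  where "conditional_assessment_index M act K \<alpha> \<longleftrightarrow>
    (\<forall>X. \<alpha> X \<in> L0_ext M) \<and> L0_local M act \<alpha> \<and> L0_quasiconcave M act \<alpha> \<and> cone_monotone M K \<alpha>"

definition L0_upper_semicontinuous ::
    "'a measure \<Rightarrow> ('x::topological_space \<Rightarrow> 'a \<Rightarrow> ereal) \<Rightarrow> bool"
  where "L0_upper_semicontinuous M \<alpha> \<longleftrightarrow>
    (\<forall>m\<in>L0_ext M. closed {X. AE \<omega> in M. m \<omega> \<le> \<alpha> X \<omega>})"

definition certainty_equivalent ::
    "'a measure \<Rightarrow> (('a \<Rightarrow> real) \<Rightarrow> 'x \<Rightarrow> 'x::ab_group_add) \<Rightarrow> 'x \<Rightarrow> ('x \<Rightarrow> 'a \<Rightarrow> ereal)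
      \<Rightarrow> ('x \<Rightarrow> 'a \<Rightarrow> real) \<Rightarrow> bool"
  where "certainty_equivalent M act \<kappa> \<alpha> C \<longleftrightarrow>
    (\<forall>X. C X \<in> L0 M) \<and> L0_local M act (\<lambda>X \<omega>. ereal (C X \<omega>)) \<and>
    (\<forall>X. AE \<omega> in M. \<alpha> (act (C X) \<kappa>) \<omega> = \<alpha> X \<omega>)"

definition kappa_bounded ::
    "'a measure \<Rightarrow> (('a \<Rightarrow> real) \<Rightarrow> 'x \<Rightarrow> 'x) \<Rightarrow> 'x \<Rightarrow> ('x \<Rightarrow> 'a \<Rightarrow> ereal) \<Rightarrow> bool"
  where "kappa_bounded M act \<kappa> \<alpha> \<longleftrightarrow>
    (\<forall>X. \<exists>m1\<in>L0 M. \<exists>m2\<in>L0 M.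
      (AE \<omega> in M. \<alpha> (act m1 \<kappa>) \<omega> < \<alpha> X \<omega>) \<and> (AE \<omega> in M. \<alpha> X \<omega> \<le> \<alpha> (act m2 \<kappa>) \<omega>))"

definition kappa_strictly_increasing ::
    "'a measure \<Rightarrow> (('a \<Rightarrow> real) \<Rightarrow> 'x \<Rightarrow> 'x) \<Rightarrow> 'x \<Rightarrow> ('x \<Rightarrow> 'a \<Rightarrow> ereal) \<Rightarrow> bool"
  where "kappa_strictly_increasing M act \<kappa> \<alpha> \<longleftrightarrow>
    (\<forall>m\<in>L0 M. \<forall>m'\<in>L0 M. \<forall>A\<in>sets M. (AE \<omega> in M. \<omega> \<in> A \<longrightarrow> m' \<omega> < m \<omega>) \<longrightarrow>
      (AE \<omega> in M. \<omega> \<in> A \<longrightarrow> \<alpha> (act m' \<kappa>) \<omega> < \<alpha> (act m \<kappa>) \<omega>))"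

definition kappa_sensitive ::
    "'a measure \<Rightarrow> (('a \<Rightarrow> real) \<Rightarrow> 'x \<Rightarrow> 'x) \<Rightarrow> 'x \<Rightarrow> ('x \<Rightarrow> 'a \<Rightarrow> ereal) \<Rightarrow> bool"
  where "kappa_sensitive M act \<kappa> \<alpha> \<longleftrightarrow>
    (\<forall>m\<in>L0 M. \<forall>Y. \<forall>A\<in>sets M. (AE \<omega> in M. \<omega> \<in> A \<longrightarrow> \<alpha> Y \<omega> < \<alpha> (act m \<kappa>) \<omega>) \<longrightarrow>
      (\<exists>e\<in>L0_nonneg M. (AE \<omega> in M. \<omega> \<in> A \<longrightarrow> 0 < e \<omega>) \<and>
        (AE \<omega> in M. \<omega> \<in> A \<longrightarrow> \<alpha> Y \<omega> \<le> \<alpha> (act (\<lambda>\<omega>. m \<omega> - e \<omega>) \<kappa>) \<omega>)))"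

text \<open>
  The essential infimum of a (possibly uncountable) family is its greatest lower bound with
  respect to almost sure order. It is determined up to null sets; \<open>ess_inf\<close> picks a version.
\<close>

definition is_ess_inf :: "'a measure \<Rightarrow> ('a \<Rightarrow> ereal) set \<Rightarrow> ('a \<Rightarrow> ereal) \<Rightarrow> bool"
  where "is_ess_inf M S g \<longleftrightarrow>
    g \<in> L0_ext M \<and> (\<forall>f\<in>S. AE \<omega> in M. g \<omega> \<le> f \<omega>) \<and>
    (\<forall>h\<in>L0_ext M. (\<forall>f\<in>S. AE \<omega> in M. h \<omega> \<le> f \<omega>) \<longrightarrow> (AE \<omega> in M. h \<omega> \<le> g \<omega>))"

definition ess_inf :: "'a measure \<Rightarrow> ('a \<Rightarrow> ereal) set \<Rightarrow> 'a \<Rightarrow> ereal"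
  where "ess_inf M S = (SOME g. is_ess_inf M S g)"

end

theory Submission imports Defs begin

text \<open>
  The set of levels \<open>m\<close> with \<open>\<alpha> (m\<kappa>) \<ge> \<alpha> X\<close> has \<open>C X\<close> as infimum of one of its sequences. Locality
  and monotonicity along \<open>\<kappa>\<close> put every \<open>C X + \<epsilon>\<close> with \<open>\<epsilon> > 0\<close> into this set, so upper
  semicontinuity of \<open>\<alpha>\<close> and continuity of \<open>m \<mapsto> m\<kappa>\<close> put \<open>C X\<close> itself into it. If \<open>\<alpha> (C X \<kappa>)\<close> exceeded
  \<open>\<alpha> X\<close> somewhere, sensitivity would allow \<open>C X\<close> to be lowered there. Hence \<open>C X\<close> is a certainty
  equivalent, and \<open>C\<close> induces the same order as \<open>\<alpha>\<close> on every event, which transfers all properties.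
\<close>

section \<open>Essential infima\<close>

text \<open>The continuous extension of \<open>arctan\<close>, an order embedding of the extended
  reals into [-pi/2, pi/2]. Expectations of rescaled infima are thus always finite, and strict
  monotonicity allows equality of the rescaled values to be undone.\<close>

definition ereal_arctan :: "ereal \<Rightarrow> real"
  where "ereal_arctan x = (if x = \<infinity> then pi / 2 else if x = -\<infinity> then - pi / 2
    else arctan (real_of_ereal x))"

lemma strict_mono_ereal_arctan: "strict_mono ereal_arctan"
proof (rule strict_monoI)
  fix x y :: ereal
  assume "x < y"
  then show "ereal_arctan x < ereal_arctan y"
    by (cases x; cases y)
      (use arctan_lbound arctan_ubound in \<open>auto simp: ereal_arctan_def arctan_less_iff field_simps\<close>)
qed

lemma abs_ereal_arctan_le: "\<bar>ereal_arctan x\<bar> \<le> pi / 2"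
  using arctan_ubound[of "real_of_ereal x"] arctan_lbound[of "real_of_ereal x"]
  by (auto simp: ereal_arctan_def)

lemma borel_measurable_ereal_arctan [measurable]: "ereal_arctan \<in> borel_measurable borel"
proof -
  have [measurable]: "(arctan :: real \<Rightarrow> real) \<in> borel_measurable borel"
    by (intro borel_measurable_continuous_onI continuous_on_arctan continuous_on_id)
  show ?thesis
    unfolding ereal_arctan_def[abs_def] by measurable
qed

lemma (in finite_measure) integrable_ereal_arctan:
  assumes "f \<in> borel_measurable M"
  shows "integrable M (\<lambda>\<omega>. ereal_arctan (f \<omega>))"
  using assms abs_ereal_arctan_le
  by (intro integrable_const_bound[where B = "pi / 2"]) (auto simp del: le_divide_eq_numeral1)

text \<open>
  A sequence from \<open>S\<close> whose infimum has least expectation, after rescaling to a bounded range,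
  already attains the essential infimum.
\<close>

lemma (in prob_space) ess_inf_countable:
  assumes "S \<noteq> {}" and S: "S \<subseteq> borel_measurable M"
  obtains c :: "nat \<Rightarrow> 'a \<Rightarrow> ereal"
  where "range c \<subseteq> S" "is_ess_inf M S (\<lambda>\<omega>. INF n. c n \<omega>)"
proof -
  define J where "J c = (\<integral>\<omega>. ereal_arctan (INF n. c n \<omega>) \<partial>M)" for c :: "nat \<Rightarrow> 'a \<Rightarrow> ereal"
  define \<C> where "\<C> = {c :: nat \<Rightarrow> 'a \<Rightarrow> ereal. range c \<subseteq> S}"
  define j where "j = Inf (J ` \<C>)"
  have arctan_mono: "ereal_arctan x \<le> ereal_arctan y" if "x \<le> y" for x y
    using that strict_mono_ereal_arctan by (simp add: strict_mono_less_eq)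
  have meas: "(\<lambda>\<omega>. INF n. c n \<omega>) \<in> borel_measurable M" if "c \<in> \<C>" for c
  proof -
    have [measurable]: "c n \<in> borel_measurable M" for n
      using that S unfolding \<C>_def by auto
    show ?thesis by measurable
  qed
  have J_mono: "J c \<le> J d" if "c \<in> \<C>" "d \<in> \<C>" "\<And>\<omega>. (INF n. c n \<omega>) \<le> (INF n. d n \<omega>)" for c d
    unfolding J_def using that
    by (intro integral_mono integrable_ereal_arctan meas arctan_mono) auto
  have "- (pi / 2) \<le> J c" if "c \<in> \<C>" for c
  proof -
    have "- (pi / 2) \<le> ereal_arctan x" for x
      using abs_ereal_arctan_le[of x] by linarith
    then have "(\<integral>\<omega>. - (pi / 2) \<partial>M) \<le> J c"
      unfolding J_def by (intro integral_mono integrable_ereal_arctan meas that) auto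
    then show ?thesis by (simp add: prob_space)
  qed
  then have bdd: "bdd_below (J ` \<C>)"
    by (intro bdd_belowI[where m = "- (pi / 2)"]) auto
  have j_le: "j \<le> J c" if "c \<in> \<C>" for c
    unfolding j_def using that bdd by (intro cInf_lower) auto
  obtain s where "s \<in> S" using assms(1) by auto
  then have "(\<lambda>_. s) \<in> \<C>" unfolding \<C>_def by auto
  then have ne: "J ` \<C> \<noteq> {}" by auto
  have "\<exists>c\<in>\<C>. J c < j + 1 / real (Suc k)" for k
    using cInf_lessD[OF ne, of "j + 1 / real (Suc k)"] unfolding j_def by auto
  then obtain c where c: "\<And>k. c k \<in> \<C>" "\<And>k. J (c k) < j + 1 / real (Suc k)"
    by metis
  \<comment> \<open>\<open>c k\<close> is minimal up to 1/(k+1). Enumerating all entries of all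
    these sequences in one sequence puts its infimum below each of theirs, so \<open>d\<close> is an
    exact minimiser of \<open>J\<close>.\<close>
  define d where "d n = c (fst (prod_decode n)) (snd (prod_decode n))" for n
  have d: "d \<in> \<C>"
    using c(1) unfolding \<C>_def d_def by auto
  have "J d \<le> J (c k)" for k
  proof (rule J_mono[OF d c(1)], rule INF_greatest)
    fix \<omega> n
    show "(INF n. d n \<omega>) \<le> c k n \<omega>"
      by (rule INF_lower2[of "prod_encode (k, n)"]) (auto simp: d_def)
  qed
  then have J_d_less: "J d < j + 1 / real (Suc k)" for k
    using c(2) by (meson le_less_trans)
  have J_d: "J d \<le> j"
  proof (rule ccontr)
    assume "\<not> J d \<le> j"
    then obtain k where "inverse (real (Suc k)) < J d - j"
      using reals_Archimedean[of "J d - j"] by auto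
    then show False using J_d_less[of k] by (simp add: inverse_eq_divide)
  qed
  have below: "AE \<omega> in M. (INF n. d n \<omega>) \<le> f \<omega>" if f: "f \<in> S" for f
  proof -
    \<comment> \<open>Prepending \<open>f\<close> can only lower the infimum, yet \<open>J e\<close>
      cannot fall below the minimum \<open>j\<close>. The nonnegative difference \<open>?h\<close>
      therefore has integral zero, and both infima agree almost surely; the one of \<open>e\<close>
      lies below \<open>f\<close>.\<close>
    define e where "e = case_nat f d"
    have e: "e \<in> \<C>"
      using d f unfolding \<C>_def e_def image_subset_iff by (auto split: nat.splits)
    have e_le: "(INF n. e n \<omega>) \<le> (INF n. d n \<omega>)" for \<omega>
      by (rule INF_greatest, rule INF_lower2[of "Suc _"]) (auto simp: e_def)
    have e_f: "(INF n. e n \<omega>) \<le> f \<omega>" for \<omega>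
      by (rule INF_lower2[of 0]) (auto simp: e_def)
    let ?h = "\<lambda>\<omega>. ereal_arctan (INF n. d n \<omega>) - ereal_arctan (INF n. e n \<omega>)"
    have int: "integrable M (\<lambda>\<omega>. ereal_arctan (INF n. d n \<omega>))"
      "integrable M (\<lambda>\<omega>. ereal_arctan (INF n. e n \<omega>))"
      by (intro integrable_ereal_arctan meas d e)+
    have nonneg: "0 \<le> ?h \<omega>" for \<omega>
      using arctan_mono[OF e_le] by simp
    have "(\<integral>\<omega>. ?h \<omega> \<partial>M) = J d - J e"
      unfolding J_def by (rule Bochner_Integration.integral_diff[OF int])
    also have "\<dots> \<le> 0"
      using J_d j_le[OF e] by simp
    finally have "(\<integral>\<omega>. ?h \<omega> \<partial>M) = 0"
      using Bochner_Integration.integral_nonneg[where f = ?h and M = M] nonneg by (meson antisym)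
    then have "AE \<omega> in M. ?h \<omega> = 0"
      using integral_nonneg_eq_0_iff_AE[of M ?h] int nonneg by auto
    then show ?thesis
    proof eventually_elim
      case (elim \<omega>)
      then have "(INF n. d n \<omega>) = (INF n. e n \<omega>)"
        using strict_mono_eq[OF strict_mono_ereal_arctan] by simp
      then show ?case using e_f by simp
    qed
  qed
  have greatest: "AE \<omega> in M. h \<omega> \<le> (INF n. d n \<omega>)" if "\<And>f. f \<in> S \<Longrightarrow> AE \<omega> in M. h \<omega> \<le> f \<omega>" for h
  proof -
    have "AE \<omega> in M. \<forall>n. h \<omega> \<le> d n \<omega>"
      using that d unfolding \<C>_def AE_all_countable by auto
    then show ?thesis by eventually_elim (auto intro: INF_greatest)
  qed
  show thesis
  proof (rule that)
    show "range d \<subseteq> S" using d unfolding \<C>_def by auto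
    show "is_ess_inf M S (\<lambda>\<omega>. INF n. d n \<omega>)"
      unfolding is_ess_inf_def using meas[OF d] below greatest by auto
  qed
qed

lemma is_ess_inf_unique_AE:
  assumes "is_ess_inf M S f" "is_ess_inf M S g"
  shows "AE \<omega> in M. f \<omega> = g \<omega>"
proof -
  have "AE \<omega> in M. f \<omega> \<le> g \<omega>" "AE \<omega> in M. g \<omega> \<le> f \<omega>"
    using assms unfolding is_ess_inf_def by auto
  then show ?thesis by eventually_elim auto
qed

section \<open>Assessment indices along the direction \<open>\<kappa>\<close>\<close>

context L0_module
begin

section \<open>Pasting and nonnegative scaling in the module\<close>

lemma act_zero_right: "f \<in> L0 M \<Longrightarrow> act f 0 = 0"
  using act_add_right[of f 0 0] by simp

lemma act_diff_left:
  assumes "f \<in> L0 M" "g \<in> L0 M"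
  shows "act (\<lambda>\<omega>. f \<omega> - g \<omega>) X = act f X - act g X"
  using act_add_left[of "\<lambda>\<omega>. f \<omega> - g \<omega>" g X] assms by (simp add: algebra_simps)

text \<open>Locality speaks of pasted module elements. For multiples of one element the pasting can
  be moved into the scalar, so levels can be modified event by event.\<close>

lemma act_if:
  assumes [measurable]: "f \<in> L0 M" "g \<in> L0 M" "A \<in> sets M"
  shows "act (indicator A) (act f X) + act (indicator (space M - A)) (act g X) =
    act (\<lambda>\<omega>. if \<omega> \<in> A then f \<omega> else g \<omega>) X"
proof -
  have "act (indicator A) (act f X) + act (indicator (space M - A)) (act g X) =
      act (\<lambda>\<omega>. indicator A \<omega> * f \<omega>) X + act (\<lambda>\<omega>. indicator (space M - A) \<omega> * g \<omega>) X"
    by (simp add: act_act)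
  also have "\<dots> = act (\<lambda>\<omega>. indicator A \<omega> * f \<omega> + indicator (space M - A) \<omega> * g \<omega>) X"
    by (rule act_add_left[symmetric]) measurable
  also have "\<dots> = act (\<lambda>\<omega>. if \<omega> \<in> A then f \<omega> else g \<omega>) X"
    by (rule act_cong_AE) (auto simp: indicator_def)
  finally show ?thesis .
qed

text \<open>The cone property handles only almost surely positive scalars. Hence \<open>l\<close> is
  split into a positive factor \<open>p\<close> and the indicator \<open>q\<close> of the event
  where \<open>l\<close> is nonzero; multiplication by \<open>q\<close> is a convex combination with
  0.\<close>

lemma convex_cone_act_nonneg:
  assumes "L0_convex M act K" "L0_cone M act K" "0 \<in> K" "X \<in> K" "l \<in> L0_nonneg M"
  shows "act l X \<in> K"
proof -
  have [measurable]: "l \<in> L0 M" and l_nonneg: "AE \<omega> in M. 0 \<le> l \<omega>"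
    using assms(5) unfolding L0_nonneg_def by auto
  define p q :: "'a \<Rightarrow> real"
    where "p = (\<lambda>\<omega>. if l \<omega> = 0 then 1 else l \<omega>)" and "q = (\<lambda>\<omega>. if l \<omega> = 0 then 0 else 1)"
  have [measurable]: "p \<in> L0 M" "q \<in> L0 M"
    unfolding p_def q_def by measurable
  have "p \<in> L0_pos M"
    unfolding L0_pos_def using l_nonneg by (auto simp: p_def)
  moreover have "q \<in> L0_unit M"
    unfolding L0_unit_def by (auto simp: q_def)
  then have "act q X + act (\<lambda>\<omega>. 1 - q \<omega>) 0 \<in> K"
    using assms unfolding L0_convex_def by blast
  then have "act q X \<in> K"
    by (simp add: act_zero_right)
  ultimately have "act p (act q X) \<in> K"
    using assms(2) unfolding L0_cone_def by blast
  moreover have "act p (act q X) = act (\<lambda>\<omega>. p \<omega> * q \<omega>) X"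
    by (simp add: act_act)
  moreover have "\<dots> = act l X"
    by (rule act_cong_AE) (auto simp: p_def q_def)
  ultimately show ?thesis by simp
qed

end

locale assessment_index = L0_module M act
  for M :: "'a measure" and act :: "('a \<Rightarrow> real) \<Rightarrow> 'x::ab_group_add \<Rightarrow> 'x" +
  fixes K :: "'x set" and \<kappa> :: 'x and \<alpha> :: "'x \<Rightarrow> 'a \<Rightarrow> ereal"
  assumes convex: "L0_convex M act K" and cone: "L0_cone M act K" and zero_mem: "0 \<in> K"
    and direction_mem: "\<kappa> \<in> K"
    and index: "conditional_assessment_index M act K \<alpha>"
begin

section \<open>Locality and monotonicity of the index in the level\<close>

lemma index_measurable [measurable]: "\<alpha> X \<in> borel_measurable M"
  using index unfolding conditional_assessment_index_def by auto

lemma index_if: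
  assumes "A \<in> sets M"
  shows "AE \<omega> in M. \<alpha> (act (indicator A) X + act (indicator (space M - A)) Y) \<omega> =
    (if \<omega> \<in> A then \<alpha> X \<omega> else \<alpha> Y \<omega>)"
proof -
  have "AE \<omega> in M. \<alpha> (act (indicator A) X + act (indicator (space M - A)) Y) \<omega> =
      indicator A \<omega> * \<alpha> X \<omega> + indicator (space M - A) \<omega> * \<alpha> Y \<omega>"
    using index assms unfolding conditional_assessment_index_def L0_local_def by blast
  then show ?thesis
    using AE_space by eventually_elim (auto simp: indicator_def)
qed

lemma index_act_if:
  assumes "f \<in> L0 M" "g \<in> L0 M" "A \<in> sets M"
  shows "AE \<omega> in M. \<alpha> (act (\<lambda>\<omega>. if \<omega> \<in> A then f \<omega> else g \<omega>) \<kappa>) \<omega> =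
    (if \<omega> \<in> A then \<alpha> (act f \<kappa>) \<omega> else \<alpha> (act g \<kappa>) \<omega>)"
  using index_if[OF assms(3), of "act f \<kappa>" "act g \<kappa>"] by (simp only: act_if[OF assms])

lemma index_act_mono:
  assumes "f \<in> L0 M" "g \<in> L0 M" "AE \<omega> in M. g \<omega> \<le> f \<omega>"
  shows "AE \<omega> in M. \<alpha> (act g \<kappa>) \<omega> \<le> \<alpha> (act f \<kappa>) \<omega>"
proof -
  have "(\<lambda>\<omega>. f \<omega> - g \<omega>) \<in> L0_nonneg M"
    using assms unfolding L0_nonneg_def by auto
  then have "act f \<kappa> - act g \<kappa> \<in> K"
    using convex_cone_act_nonneg[OF convex cone zero_mem direction_mem, of "\<lambda>\<omega>. f \<omega> - g \<omega>"]
    by (simp only: act_diff_left[OF assms(1,2)])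
  then show ?thesis
    using index unfolding conditional_assessment_index_def cone_monotone_def by blast
qed

text \<open>Replacing \<open>g\<close> by \<open>f\<close> on \<open>A\<close> only yields a level
  above \<open>g\<close> everywhere, to which global monotonicity applies; locality then reads off
  the result on \<open>A\<close>.\<close>

lemma index_act_mono_on:
  assumes [measurable]: "f \<in> L0 M" "g \<in> L0 M" and A [measurable]: "A \<in> sets M"
    and le: "AE \<omega> in M. \<omega> \<in> A \<longrightarrow> g \<omega> \<le> f \<omega>"
  shows "AE \<omega> in M. \<omega> \<in> A \<longrightarrow> \<alpha> (act g \<kappa>) \<omega> \<le> \<alpha> (act f \<kappa>) \<omega>"
proof -
  let ?h = "\<lambda>\<omega>. if \<omega> \<in> A then f \<omega> else g \<omega>"
  have "AE \<omega> in M. g \<omega> \<le> ?h \<omega>"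
    using le by eventually_elim auto
  then have "AE \<omega> in M. \<alpha> (act g \<kappa>) \<omega> \<le> \<alpha> (act ?h \<kappa>) \<omega>"
    by (intro index_act_mono) measurable
  moreover have "AE \<omega> in M. \<alpha> (act ?h \<kappa>) \<omega> =
      (if \<omega> \<in> A then \<alpha> (act f \<kappa>) \<omega> else \<alpha> (act g \<kappa>) \<omega>)"
    by (rule index_act_if) measurable
  ultimately show ?thesis by eventually_elim auto
qed

text \<open>On the event where \<open>f\<close> is at most \<open>g\<close>, monotonicity
  contradicts the strict inequality of the indices, so this event is null. This will bound all
  admissible levels from below.\<close>

lemma act_less_if_index_less:
  assumes [measurable]: "f \<in> L0 M" "g \<in> L0 M"
    and less: "AE \<omega> in M. \<alpha> (act g \<kappa>) \<omega> < \<alpha> (act f \<kappa>) \<omega>"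
  shows "AE \<omega> in M. g \<omega> < f \<omega>"
proof -
  let ?A = "{\<omega> \<in> space M. f \<omega> \<le> g \<omega>}"
  have "AE \<omega> in M. \<omega> \<in> ?A \<longrightarrow> \<alpha> (act f \<kappa>) \<omega> \<le> \<alpha> (act g \<kappa>) \<omega>"
    by (rule index_act_mono_on) auto
  then show ?thesis
    using less AE_space by eventually_elim auto
qed

lemma strictly_increasing_inj:
  assumes "kappa_strictly_increasing M act \<kappa> \<alpha>"
    and [measurable]: "f \<in> L0 M" "g \<in> L0 M"
    and eq: "AE \<omega> in M. \<alpha> (act f \<kappa>) \<omega> = \<alpha> (act g \<kappa>) \<omega>"
  shows "AE \<omega> in M. f \<omega> = g \<omega>"
proof -
  have less: "AE \<omega> in M. \<omega> \<in> {\<omega> \<in> space M. u \<omega> < v \<omega>} \<longrightarrow> \<alpha> (act u \<kappa>) \<omega> < \<alpha> (act v \<kappa>) \<omega>"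
    if [measurable]: "u \<in> L0 M" "v \<in> L0 M" for u v
  proof -
    have "{\<omega> \<in> space M. u \<omega> < v \<omega>} \<in> sets M" by measurable
    from assms(1)[unfolded kappa_strictly_increasing_def, rule_format, OF that(2,1) this]
    show ?thesis by auto
  qed
  show ?thesis
    using eq less[OF assms(2,3)] less[OF assms(3,2)] AE_space
  proof eventually_elim
    case (elim \<omega>)
    then show ?case by (cases "f \<omega>" "g \<omega>" rule: linorder_cases) auto
  qed
qed

end

section \<open>The certainty equivalent\<close>

locale usc_assessment_index = locally_L0_convex_module M act + assessment_index M act K \<kappa> \<alpha>
  for M :: "'a measure" and act :: "('a \<Rightarrow> real) \<Rightarrow> 'x::topological_ab_group_add \<Rightarrow> 'x"
    and K :: "'x set" and \<kappa> :: 'x and \<alpha> :: "'x \<Rightarrow> 'a \<Rightarrow> ereal" +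
  fixes C :: "'x \<Rightarrow> 'a \<Rightarrow> ereal"
  assumes sensitive: "kappa_sensitive M act \<kappa> \<alpha>"
    and bounded: "kappa_bounded M act \<kappa> \<alpha>"
    and usc: "L0_upper_semicontinuous M \<alpha>"
    and C_eq: "C X = ess_inf M {\<lambda>\<omega>. ereal (m \<omega>) | m. m \<in> L0 M \<and>
                 (AE \<omega> in M. \<alpha> X \<omega> \<le> \<alpha> (act m \<kappa>) \<omega>)}"
begin

section \<open>The essential infimum: countable representation and finiteness\<close>

lemma C_is_ess_inf:
  "is_ess_inf M {\<lambda>\<omega>. ereal (m \<omega>) | m. m \<in> L0 M \<and> (AE \<omega> in M. \<alpha> X \<omega> \<le> \<alpha> (act m \<kappa>) \<omega>)} (C X)"
  and C_countable: "\<exists>c :: nat \<Rightarrow> 'a \<Rightarrow> real. (\<forall>n. c n \<in> L0 M) \<and>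
    (\<forall>n. AE \<omega> in M. \<alpha> X \<omega> \<le> \<alpha> (act (c n) \<kappa>) \<omega>) \<and> (AE \<omega> in M. C X \<omega> = (INF n. ereal (c n \<omega>)))"
proof -
  let ?S = "{\<lambda>\<omega>. ereal (m \<omega>) | m. m \<in> L0 M \<and> (AE \<omega> in M. \<alpha> X \<omega> \<le> \<alpha> (act m \<kappa>) \<omega>)}"
  \<comment> \<open>The upper level provided by boundedness is a member.\<close>
  have ne: "?S \<noteq> {}"
    using bounded unfolding kappa_bounded_def by blast
  have meas: "?S \<subseteq> borel_measurable M"
    by auto
  obtain d :: "nat \<Rightarrow> 'a \<Rightarrow> ereal"
    where d: "range d \<subseteq> ?S" "is_ess_inf M ?S (\<lambda>\<omega>. INF n. d n \<omega>)"
    by (rule ess_inf_countable[OF ne meas])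
  have "\<forall>n. \<exists>m. d n = (\<lambda>\<omega>. ereal (m \<omega>)) \<and> m \<in> L0 M \<and> (AE \<omega> in M. \<alpha> X \<omega> \<le> \<alpha> (act m \<kappa>) \<omega>)"
    using d(1) by auto
  then obtain c where c: "\<And>n. d n = (\<lambda>\<omega>. ereal (c n \<omega>))" "\<And>n. c n \<in> L0 M"
      "\<And>n. AE \<omega> in M. \<alpha> X \<omega> \<le> \<alpha> (act (c n) \<kappa>) \<omega>"
    by metis
  \<comment> \<open>\<open>ess_inf\<close> picks an arbitrary version, so existence of some
    essential infimum has to come first; uniqueness then transfers the countable formula to the
    chosen version almost surely.\<close>
  show C: "is_ess_inf M ?S (C X)"
    unfolding C_eq ess_inf_def by (rule someI[of "is_ess_inf M ?S", OF d(2)])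
  have "AE \<omega> in M. C X \<omega> = (INF n. ereal (c n \<omega>))"
    using is_ess_inf_unique_AE[OF C d(2)] c(1) by simp
  then show "\<exists>c :: nat \<Rightarrow> 'a \<Rightarrow> real. (\<forall>n. c n \<in> L0 M) \<and>
      (\<forall>n. AE \<omega> in M. \<alpha> X \<omega> \<le> \<alpha> (act (c n) \<kappa>) \<omega>) \<and> (AE \<omega> in M. C X \<omega> = (INF n. ereal (c n \<omega>)))"
    using c(2,3) by blast
qed

lemma C_measurable [measurable]: "C X \<in> borel_measurable M"
  using C_is_ess_inf unfolding is_ess_inf_def by blast

lemma C_le:
  assumes "m \<in> L0 M" "AE \<omega> in M. \<alpha> X \<omega> \<le> \<alpha> (act m \<kappa>) \<omega>"
  shows "AE \<omega> in M. C X \<omega> \<le> ereal (m \<omega>)"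
proof -
  have "(\<lambda>\<omega>. ereal (m \<omega>)) \<in> {\<lambda>\<omega>. ereal (m \<omega>) | m. m \<in> L0 M \<and>
      (AE \<omega> in M. \<alpha> X \<omega> \<le> \<alpha> (act m \<kappa>) \<omega>)}"
    using assms by blast
  from C_is_ess_inf[of X, unfolded is_ess_inf_def, THEN conjunct2, THEN conjunct1, rule_format, OF this]
  show ?thesis .
qed

text \<open>Both bounds come from \<kappa>-boundedness: \<open>m2\<close> is itself admissible, and
  every level \<open>c n\<close> has an index strictly above that of \<open>m1\<close>, hence
  exceeds \<open>m1\<close>. Countability of the sequence leaves a single null set.\<close>

lemma C_finite: "AE \<omega> in M. \<bar>C X \<omega>\<bar> \<noteq> \<infinity>"
proof -
  obtain m1 m2 where m: "m1 \<in> L0 M" "m2 \<in> L0 M" "AE \<omega> in M. \<alpha> (act m1 \<kappa>) \<omega> < \<alpha> X \<omega>"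
      "AE \<omega> in M. \<alpha> X \<omega> \<le> \<alpha> (act m2 \<kappa>) \<omega>"
    using bounded unfolding kappa_bounded_def by blast
  obtain c :: "nat \<Rightarrow> 'a \<Rightarrow> real" where c: "\<And>n. c n \<in> L0 M" "\<And>n. AE \<omega> in M. \<alpha> X \<omega> \<le> \<alpha> (act (c n) \<kappa>) \<omega>"
      "AE \<omega> in M. C X \<omega> = (INF n. ereal (c n \<omega>))"
    using C_countable[of X] by blast
  have "AE \<omega> in M. m1 \<omega> < c n \<omega>" for n
  proof (rule act_less_if_index_less[OF c(1) m(1)])
    show "AE \<omega> in M. \<alpha> (act m1 \<kappa>) \<omega> < \<alpha> (act (c n) \<kappa>) \<omega>"
      using m(3) c(2)[of n] by eventually_elim auto
  qed
  then have "AE \<omega> in M. \<forall>n. m1 \<omega> < c n \<omega>"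
    by (simp add: AE_all_countable)
  then show ?thesis
    using c(3) C_le[OF m(2,4)]
  proof eventually_elim
    case (elim \<omega>)
    have "ereal (m1 \<omega>) \<le> C X \<omega>"
      unfolding elim(2) using elim(1) by (intro INF_greatest) (auto intro: less_imp_le)
    then show ?case using elim(3) by (cases "C X \<omega>") auto
  qed
qed

text \<open>A real-valued version of \<open>C\<close>, since only real functions act on the module.
  The value 0 given to infinities occurs on a null set only.\<close>

definition CE :: "'x \<Rightarrow> 'a \<Rightarrow> real"
  where "CE X \<omega> = real_of_ereal (C X \<omega>)"

lemma CE_measurable [measurable]: "CE X \<in> L0 M"
  unfolding CE_def[abs_def] by measurable

lemma ereal_CE: "AE \<omega> in M. ereal (CE X \<omega>) = C X \<omega>"
  using C_finite[of X] by eventually_elim (auto simp: CE_def ereal_real)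

lemma CE_le:
  assumes "m \<in> L0 M" "AE \<omega> in M. \<alpha> X \<omega> \<le> \<alpha> (act m \<kappa>) \<omega>"
  shows "AE \<omega> in M. CE X \<omega> \<le> m \<omega>"
  using C_le[OF assms] ereal_CE[of X] by eventually_elim (metis ereal_less_eq(3))

text \<open>Almost every point has some \<open>c n\<close> below \<open>CE X + e\<close>, with
  \<open>n\<close> depending on the point. The countably many events \<open>?A n\<close> therefore
  cover the space up to a null set, and on each of them monotonicity passes from the admissible
  \<open>c n\<close> to \<open>CE X + e\<close>.\<close>

lemma index_le_act_CE_plus:
  assumes "e \<in> L0_pos M"
  shows "AE \<omega> in M. \<alpha> X \<omega> \<le> \<alpha> (act (\<lambda>\<omega>. CE X \<omega> + e \<omega>) \<kappa>) \<omega>"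
proof -
  have [measurable]: "e \<in> L0 M" and e: "AE \<omega> in M. 0 < e \<omega>"
    using assms unfolding L0_pos_def by auto
  obtain c :: "nat \<Rightarrow> 'a \<Rightarrow> real" where c [measurable]: "\<And>n. c n \<in> L0 M"
    and acc: "\<And>n. AE \<omega> in M. \<alpha> X \<omega> \<le> \<alpha> (act (c n) \<kappa>) \<omega>"
    and C_INF: "AE \<omega> in M. C X \<omega> = (INF n. ereal (c n \<omega>))"
    using C_countable[of X] by blast
  let ?A = "\<lambda>n. {\<omega> \<in> space M. c n \<omega> \<le> CE X \<omega> + e \<omega>}"
  have "AE \<omega> in M. \<omega> \<in> ?A n \<longrightarrow> \<alpha> (act (c n) \<kappa>) \<omega> \<le> \<alpha> (act (\<lambda>\<omega>. CE X \<omega> + e \<omega>) \<kappa>) \<omega>" for n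
    by (rule index_act_mono_on) auto
  then have "AE \<omega> in M. \<forall>n. \<omega> \<in> ?A n \<longrightarrow>
      \<alpha> (act (c n) \<kappa>) \<omega> \<le> \<alpha> (act (\<lambda>\<omega>. CE X \<omega> + e \<omega>) \<kappa>) \<omega>"
    by (simp add: AE_all_countable)
  moreover have "AE \<omega> in M. \<forall>n. \<alpha> X \<omega> \<le> \<alpha> (act (c n) \<kappa>) \<omega>"
    using acc by (simp add: AE_all_countable)
  ultimately show ?thesis
    using C_INF ereal_CE[of X] e AE_space
  proof eventually_elim
    case (elim \<omega>)
    have "(INF n. ereal (c n \<omega>)) < ereal (CE X \<omega> + e \<omega>)"
      using elim(3,4,5) by (metis ereal_less(2) less_add_same_cancel1 less_ereal.simps(1))
    then obtain n where "ereal (c n \<omega>) < ereal (CE X \<omega> + e \<omega>)"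
      unfolding INF_less_iff by blast
    then have "\<omega> \<in> ?A n" using elim(6) by simp
    then show ?case using elim(1,2) order_trans by blast
  qed
qed

section \<open>Attainment of the infimum\<close>

lemma continuous_map_act_left: "continuous_map (L0_topology M) euclidean (\<lambda>f. act f X)"
proof -
  have "continuous_map (L0_topology M) (prod_topology (L0_topology M) euclidean) (\<lambda>f. (f, X))"
    by (simp add: continuous_map_pairedI)
  from continuous_map_compose[OF this continuous_act] show ?thesis
    by (simp add: comp_def)
qed

lemma topspace_L0_topology: "topspace (L0_topology M) = L0 M"
proof -
  have "openin (L0_topology M) (L0 M)"
    unfolding openin_L0_topology
    by (auto simp: L0_ball_def L0_pos_def intro!: exI[of _ "\<lambda>_. 1"])
  then show ?thesis
    using openin_L0_topology[of M "topspace (L0_topology M)"] openin_subset by blast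
qed

text \<open>Upper semicontinuity at the random level \<open>\<alpha> X\<close> makes
  \<open>?F\<close> closed, so the levels mapped outside \<open>?F\<close> form an open set. If it
  contained \<open>CE X\<close>, it would contain a ball of some radius \<open>e\<close> and with it
  \<open>CE X + e\<close>, which is mapped into \<open>?F\<close>.\<close>

lemma index_le_act_CE: "AE \<omega> in M. \<alpha> X \<omega> \<le> \<alpha> (act (CE X) \<kappa>) \<omega>"
proof -
  let ?F = "{Y. AE \<omega> in M. \<alpha> X \<omega> \<le> \<alpha> Y \<omega>}"
  have "closed ?F"
    using usc index_measurable unfolding L0_upper_semicontinuous_def by blast
  then have op: "openin (L0_topology M) {f \<in> L0 M. act f \<kappa> \<in> - ?F}"
    using openin_continuous_map_preimage[OF continuous_map_act_left[of \<kappa>], of "- ?F"]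
    by (simp add: topspace_L0_topology open_Compl)
  have "act (CE X) \<kappa> \<in> ?F"
  proof (rule ccontr)
    assume "act (CE X) \<kappa> \<notin> ?F"
    then have "CE X \<in> {f \<in> L0 M. act f \<kappa> \<in> - ?F}"
      using CE_measurable by blast
    then obtain e where e: "e \<in> L0_pos M" "L0_ball M (CE X) e \<subseteq> {f \<in> L0 M. act f \<kappa> \<in> - ?F}"
      using op unfolding openin_L0_topology by blast
    have "e \<in> L0 M" "AE \<omega> in M. 0 < e \<omega>"
      using e(1) unfolding L0_pos_def by auto
    then have "(\<lambda>\<omega>. CE X \<omega> + e \<omega>) \<in> L0_ball M (CE X) e"
      unfolding L0_ball_def by auto
    then show False
      using e(2) index_le_act_CE_plus[OF e(1)] by blast
  qed
  then show ?thesis by simp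
qed

lemma index_act_CE: "AE \<omega> in M. \<alpha> (act (CE X) \<kappa>) \<omega> = \<alpha> X \<omega>"
proof -
  define A where "A = {\<omega> \<in> space M. \<alpha> X \<omega> < \<alpha> (act (CE X) \<kappa>) \<omega>}"
  have A [measurable]: "A \<in> sets M"
    unfolding A_def by measurable
  have "AE \<omega> in M. \<omega> \<in> A \<longrightarrow> \<alpha> X \<omega> < \<alpha> (act (CE X) \<kappa>) \<omega>"
    unfolding A_def by auto
  then obtain e where e: "e \<in> L0_nonneg M" "AE \<omega> in M. \<omega> \<in> A \<longrightarrow> 0 < e \<omega>"
      "AE \<omega> in M. \<omega> \<in> A \<longrightarrow> \<alpha> X \<omega> \<le> \<alpha> (act (\<lambda>\<omega>. CE X \<omega> - e \<omega>) \<kappa>) \<omega>"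
    using sensitive A CE_measurable unfolding kappa_sensitive_def by blast
  have [measurable]: "e \<in> L0 M"
    using e(1) unfolding L0_nonneg_def by auto
  \<comment> \<open>The level is lowered exactly where the index is too large. It remains
    admissible, so \<open>CE X\<close> lies below it; since \<open>e\<close> is positive on
    \<open>A\<close>, this forces \<open>A\<close> to be null.\<close>
  let ?m = "\<lambda>\<omega>. if \<omega> \<in> A then CE X \<omega> - e \<omega> else CE X \<omega>"
  have "AE \<omega> in M. \<alpha> (act ?m \<kappa>) \<omega> =
      (if \<omega> \<in> A then \<alpha> (act (\<lambda>\<omega>. CE X \<omega> - e \<omega>) \<kappa>) \<omega> else \<alpha> (act (CE X) \<kappa>) \<omega>)"
    by (rule index_act_if) measurable
  then have "AE \<omega> in M. \<alpha> X \<omega> \<le> \<alpha> (act ?m \<kappa>) \<omega>"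
    using e(3) index_le_act_CE[of X] by eventually_elim auto
  then have "AE \<omega> in M. CE X \<omega> \<le> ?m \<omega>"
    by (intro CE_le) measurable
  then show ?thesis
    using e(2) index_le_act_CE[of X] AE_space
    by eventually_elim (auto simp: A_def not_less split: if_splits intro: antisym)
qed

section \<open>Equivalence of the orders induced by \<alpha> and \<open>C\<close>\<close>

lemma C_mono_on:
  assumes [measurable]: "A \<in> sets M" and le: "AE \<omega> in M. \<omega> \<in> A \<longrightarrow> \<alpha> X \<omega> \<le> \<alpha> Y \<omega>"
  shows "AE \<omega> in M. \<omega> \<in> A \<longrightarrow> C X \<omega> \<le> C Y \<omega>"
proof -
  \<comment> \<open>This level is admissible for \<open>X\<close>: on \<open>A\<close> it has the
    index of \<open>Y\<close>, and elsewhere that of \<open>X\<close>.\<close>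
  let ?m = "\<lambda>\<omega>. if \<omega> \<in> A then CE Y \<omega> else CE X \<omega>"
  have "AE \<omega> in M. \<alpha> (act ?m \<kappa>) \<omega> =
      (if \<omega> \<in> A then \<alpha> (act (CE Y) \<kappa>) \<omega> else \<alpha> (act (CE X) \<kappa>) \<omega>)"
    by (rule index_act_if) measurable
  then have "AE \<omega> in M. \<alpha> X \<omega> \<le> \<alpha> (act ?m \<kappa>) \<omega>"
    using le index_act_CE[of X] index_act_CE[of Y] by eventually_elim auto
  then have "AE \<omega> in M. C X \<omega> \<le> ereal (?m \<omega>)"
    by (intro C_le) measurable
  then show ?thesis
    using ereal_CE[of Y] by eventually_elim auto
qed

lemma index_mono_on:
  assumes [measurable]: "A \<in> sets M" and le: "AE \<omega> in M. \<omega> \<in> A \<longrightarrow> C X \<omega> \<le> C Y \<omega>"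
  shows "AE \<omega> in M. \<omega> \<in> A \<longrightarrow> \<alpha> X \<omega> \<le> \<alpha> Y \<omega>"
proof -
  have "AE \<omega> in M. \<omega> \<in> A \<longrightarrow> CE X \<omega> \<le> CE Y \<omega>"
    using le ereal_CE[of X] ereal_CE[of Y] by eventually_elim (metis ereal_less_eq(3))
  then have "AE \<omega> in M. \<omega> \<in> A \<longrightarrow> \<alpha> (act (CE X) \<kappa>) \<omega> \<le> \<alpha> (act (CE Y) \<kappa>) \<omega>"
    by (intro index_act_mono_on) measurable
  then show ?thesis
    using index_act_CE[of X] index_act_CE[of Y] by eventually_elim auto
qed

text \<open>The localised implications are applied to the very events where their premises hold. In
  this pointwise form, any property expressed by comparisons of finitely many index values passes
  from \<alpha> to \<open>C\<close>.\<close>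

lemma C_le_iff_index_le: "AE \<omega> in M. C X \<omega> \<le> C Y \<omega> \<longleftrightarrow> \<alpha> X \<omega> \<le> \<alpha> Y \<omega>"
proof -
  have "AE \<omega> in M. \<omega> \<in> {\<omega> \<in> space M. \<alpha> X \<omega> \<le> \<alpha> Y \<omega>} \<longrightarrow> C X \<omega> \<le> C Y \<omega>"
    by (rule C_mono_on) auto
  moreover have "AE \<omega> in M. \<omega> \<in> {\<omega> \<in> space M. C X \<omega> \<le> C Y \<omega>} \<longrightarrow> \<alpha> X \<omega> \<le> \<alpha> Y \<omega>"
    by (rule index_mono_on) auto
  ultimately show ?thesis
    using AE_space by eventually_elim auto
qed

lemma order_equivalent:
  "(AE \<omega> in M. \<alpha> Y \<omega> \<le> \<alpha> X \<omega>) \<longleftrightarrow> (AE \<omega> in M. C Y \<omega> \<le> C X \<omega>)"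
  using C_le_iff_index_le[of Y X] by (intro eventually_subst) (simp add: eq_commute)

section \<open>Transfer of the properties of \<alpha> to \<open>C\<close>\<close>

lemma C_local: "L0_local M act C"
  unfolding L0_local_def
proof (intro allI ballI)
  fix X Y A assume A: "A \<in> sets M"
  let ?Z = "act (indicator A) X + act (indicator (space M - A)) Y"
  \<comment> \<open>Equality of \<alpha> at \<open>?Z\<close> and \<open>X\<close> on
    \<open>A\<close>, and at \<open>?Z\<close> and \<open>Y\<close> off \<open>A\<close>, is split
    into two inequalities each, which carry over to \<open>C\<close>.\<close>
  show "AE \<omega> in M. C ?Z \<omega> = indicator A \<omega> * C X \<omega> + indicator (space M - A) \<omega> * C Y \<omega>"
    using index_if[OF A, of X Y] C_le_iff_index_le[of ?Z X] C_le_iff_index_le[of ?Z Y]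
      C_le_iff_index_le[of X ?Z] C_le_iff_index_le[of Y ?Z] AE_space
    by eventually_elim (auto simp: indicator_def intro!: antisym)
qed

lemma C_index: "conditional_assessment_index M act K C"
  unfolding conditional_assessment_index_def
proof (intro conjI allI C_local C_measurable)
  show "L0_quasiconcave M act C"
    unfolding L0_quasiconcave_def
  proof (intro allI ballI)
    fix X Y l assume l: "l \<in> L0_unit M"
    let ?Z = "act l X + act (\<lambda>\<omega>. 1 - l \<omega>) Y"
    \<comment> \<open>A minimum lies below a value iff one of its arguments does, so quasiconcavity
      is a disjunction of comparisons and depends on the induced order only.\<close>
    have "AE \<omega> in M. min (\<alpha> X \<omega>) (\<alpha> Y \<omega>) \<le> \<alpha> ?Z \<omega>"
      using index l unfolding conditional_assessment_index_def L0_quasiconcave_def by blast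
    then show "AE \<omega> in M. min (C X \<omega>) (C Y \<omega>) \<le> C ?Z \<omega>"
      using C_le_iff_index_le[of X ?Z] C_le_iff_index_le[of Y ?Z]
      by eventually_elim (simp only: min_le_iff_disj)
  qed
  show "cone_monotone M K C"
    using index order_equivalent
    unfolding conditional_assessment_index_def cone_monotone_def by blast
qed

text \<open>Negating the order equivalence transfers strict inequalities on \<open>A\<close> as
  well, so the \<open>e\<close> obtained for \<alpha> also serves \<open>C\<close>.\<close>

lemma C_sensitive: "kappa_sensitive M act \<kappa> C"
  unfolding kappa_sensitive_def
proof (intro ballI allI impI)
  fix m Y A
  assume m: "m \<in> L0 M" and A: "A \<in> sets M"
    and less: "AE \<omega> in M. \<omega> \<in> A \<longrightarrow> C Y \<omega> < C (act m \<kappa>) \<omega>"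
  have "AE \<omega> in M. \<omega> \<in> A \<longrightarrow> \<alpha> Y \<omega> < \<alpha> (act m \<kappa>) \<omega>"
    using less C_le_iff_index_le[of "act m \<kappa>" Y] by eventually_elim (simp add: not_le[symmetric])
  then obtain e where e: "e \<in> L0_nonneg M" "AE \<omega> in M. \<omega> \<in> A \<longrightarrow> 0 < e \<omega>"
      "AE \<omega> in M. \<omega> \<in> A \<longrightarrow> \<alpha> Y \<omega> \<le> \<alpha> (act (\<lambda>\<omega>. m \<omega> - e \<omega>) \<kappa>) \<omega>"
    using sensitive m A unfolding kappa_sensitive_def by blast
  then show "\<exists>e\<in>L0_nonneg M. (AE \<omega> in M. \<omega> \<in> A \<longrightarrow> 0 < e \<omega>) \<and>
      (AE \<omega> in M. \<omega> \<in> A \<longrightarrow> C Y \<omega> \<le> C (act (\<lambda>\<omega>. m \<omega> - e \<omega>) \<kappa>) \<omega>)"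
    using C_mono_on[OF A e(3)] by blast
qed

lemma C_bounded: "kappa_bounded M act \<kappa> C"
  unfolding kappa_bounded_def
proof
  fix X
  obtain m1 m2 where m: "m1 \<in> L0 M" "m2 \<in> L0 M" "AE \<omega> in M. \<alpha> (act m1 \<kappa>) \<omega> < \<alpha> X \<omega>"
      "AE \<omega> in M. \<alpha> X \<omega> \<le> \<alpha> (act m2 \<kappa>) \<omega>"
    using bounded unfolding kappa_bounded_def by blast
  have "AE \<omega> in M. C (act m1 \<kappa>) \<omega> < C X \<omega>"
    using m(3) C_le_iff_index_le[of X "act m1 \<kappa>"]
    by eventually_elim (simp add: not_le[symmetric])
  moreover have "AE \<omega> in M. C X \<omega> \<le> C (act m2 \<kappa>) \<omega>"
    using m(4) order_equivalent by blast
  ultimately show "\<exists>m1\<in>L0 M. \<exists>m2\<in>L0 M. (AE \<omega> in M. C (act m1 \<kappa>) \<omega> < C X \<omega>) \<and>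
      (AE \<omega> in M. C X \<omega> \<le> C (act m2 \<kappa>) \<omega>)"
    using m(1,2) by blast
qed

lemma CE_certainty_equivalent: "certainty_equivalent M act \<kappa> \<alpha> CE"
  unfolding certainty_equivalent_def
proof (intro conjI allI index_act_CE CE_measurable)
  show "L0_local M act (\<lambda>X \<omega>. ereal (CE X \<omega>))"
    unfolding L0_local_def
  proof (intro allI ballI)
    fix X Y A assume A: "A \<in> sets M"
    let ?Z = "act (indicator A) X + act (indicator (space M - A)) Y"
    have "AE \<omega> in M. C ?Z \<omega> = indicator A \<omega> * C X \<omega> + indicator (space M - A) \<omega> * C Y \<omega>"
      using C_local A unfolding L0_local_def by blast
    then show "AE \<omega> in M. ereal (CE ?Z \<omega>) =
        indicator A \<omega> * ereal (CE X \<omega>) + indicator (space M - A) \<omega> * ereal (CE Y \<omega>)"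
      using ereal_CE[of X] ereal_CE[of Y] ereal_CE[of ?Z] by eventually_elim simp
  qed
qed

section \<open>Consequences of strict monotonicity: uniqueness and upper semicontinuity\<close>

lemma certainty_equivalent_unique:
  assumes "kappa_strictly_increasing M act \<kappa> \<alpha>" "certainty_equivalent M act \<kappa> \<alpha> C'"
  shows "AE \<omega> in M. ereal (C' X \<omega>) = C X \<omega>"
proof -
  have C': "C' X \<in> L0 M" "AE \<omega> in M. \<alpha> (act (C' X) \<kappa>) \<omega> = \<alpha> X \<omega>"
    using assms(2) unfolding certainty_equivalent_def by auto
  have "AE \<omega> in M. \<alpha> (act (C' X) \<kappa>) \<omega> = \<alpha> (act (CE X) \<kappa>) \<omega>"
    using C'(2) index_act_CE[of X] by eventually_elim simp
  then have "AE \<omega> in M. C' X \<omega> = CE X \<omega>"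
    by (rule strictly_increasing_inj[OF assms(1) C'(1) CE_measurable])
  then show ?thesis
    using ereal_CE[of X] by eventually_elim simp
qed

text \<open>The levels \<open>m\<close> and \<open>CE (act m \<kappa>)\<close> have the same index,
  and strict monotonicity makes the index injective in the level. A finite level of \<open>C\<close>
  can thus be rewritten as a value of \<open>C\<close>, to which the order equivalence
  applies.\<close>

lemma C_act:
  assumes "kappa_strictly_increasing M act \<kappa> \<alpha>" "m \<in> L0 M"
  shows "AE \<omega> in M. C (act m \<kappa>) \<omega> = ereal (m \<omega>)"
  using strictly_increasing_inj[OF assms(1) CE_measurable assms(2) index_act_CE]
    ereal_CE[of "act m \<kappa>"]
  by eventually_elim simp

text \<open>
  Where the level \<open>m\<close> is finite, \<open>C X \<ge> m\<close> means \<open>\<alpha> X \<ge> \<alpha> (m\<kappa>)\<close>; where it is \<open>-\<infinity>\<close> there is no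
  constraint; and it is never reached where it is \<open>\<infinity>\<close>.
\<close>

lemma C_upper_semicontinuous:
  assumes incr: "kappa_strictly_increasing M act \<kappa> \<alpha>"
  shows "L0_upper_semicontinuous M C"
  unfolding L0_upper_semicontinuous_def
proof
  fix m :: "'a \<Rightarrow> ereal"
  assume [measurable]: "m \<in> L0_ext M"
  show "closed {X. AE \<omega> in M. m \<omega> \<le> C X \<omega>}"
  proof (cases "AE \<omega> in M. m \<omega> \<noteq> \<infinity>")
    case True
    \<comment> \<open>Where \<open>m\<close> is -\<infinity>, \<open>r\<close> has the default value
      0; there \<open>l\<close> is set to -\<infinity> explicitly, so this value has no influence on
      \<open>l\<close>.\<close>
    define r where "r \<omega> = real_of_ereal (m \<omega>)" for \<omega>
    define l where "l \<omega> = (if m \<omega> = -\<infinity> then -\<infinity> else \<alpha> (act r \<kappa>) \<omega>)" for \<omega>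
    have r [measurable]: "r \<in> L0 M"
      unfolding r_def[abs_def] by measurable
    have "l \<in> L0_ext M"
      unfolding l_def[abs_def] by measurable
    then have closed: "closed {X. AE \<omega> in M. l \<omega> \<le> \<alpha> X \<omega>}"
      using usc unfolding L0_upper_semicontinuous_def by blast
    have "AE \<omega> in M. m \<omega> \<le> C X \<omega> \<longleftrightarrow> l \<omega> \<le> \<alpha> X \<omega>" for X
      using True C_act[OF incr r] C_le_iff_index_le[of "act r \<kappa>" X]
    proof eventually_elim
      case (elim \<omega>)
      then show ?case by (cases "m \<omega>") (auto simp: l_def r_def)
    qed
    then have "(AE \<omega> in M. m \<omega> \<le> C X \<omega>) \<longleftrightarrow> (AE \<omega> in M. l \<omega> \<le> \<alpha> X \<omega>)" for X
      by (rule eventually_subst)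
    then show ?thesis using closed by simp
  next
    case False
    \<comment> \<open>Here \<open>m\<close> is \<infinity> with positive probability while
      \<open>C X\<close> is almost surely finite, so the superlevel set is empty and hence
      closed.\<close>
    have "\<not> (AE \<omega> in M. m \<omega> \<le> C X \<omega>)" for X
    proof
      assume "AE \<omega> in M. m \<omega> \<le> C X \<omega>"
      then have "AE \<omega> in M. m \<omega> \<noteq> \<infinity>"
        using C_finite[of X] by eventually_elim auto
      then show False using False by simp
    qed
    then show ?thesis by simp
  qed
qed

end

theorem proposition2p19:
  fixes M :: "'a measure"
    and act :: "('a \<Rightarrow> real) \<Rightarrow> 'x::topological_ab_group_add \<Rightarrow> 'x"
    and K :: "'x set" and \<kappa> :: 'x
    and \<alpha> C :: "'x \<Rightarrow> 'a \<Rightarrow> ereal"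
  assumes "locally_L0_convex_module M act"
    and "sigma_stable M act"
    and "nbhds0_sigma_stable M act"
    and "closed K" and "L0_convex M act K" and "L0_cone M act K" and "0 \<in> K"
    and "\<kappa> \<in> K - {0}"
    and "conditional_assessment_index M act K \<alpha>"
    and "kappa_sensitive M act \<kappa> \<alpha>"
    and "kappa_bounded M act \<kappa> \<alpha>"
    and "L0_upper_semicontinuous M \<alpha>"
    and C_def: "\<And>X. C X = ess_inf M {\<lambda>\<omega>. ereal (m \<omega>) | m. m \<in> L0 M \<and>
                   (AE \<omega> in M. \<alpha> (act m \<kappa>) \<omega> \<ge> \<alpha> X \<omega>)}"
  shows "(\<forall>X. AE \<omega> in M. \<bar>C X \<omega>\<bar> \<noteq> \<infinity>)
    \<and> certainty_equivalent M act \<kappa> \<alpha> (\<lambda>X \<omega>. real_of_ereal (C X \<omega>))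
    \<and> (\<forall>X Y. (AE \<omega> in M. \<alpha> X \<omega> \<ge> \<alpha> Y \<omega>) \<longleftrightarrow> (AE \<omega> in M. C X \<omega> \<ge> C Y \<omega>))
    \<and> conditional_assessment_index M act K C
    \<and> kappa_sensitive M act \<kappa> C
    \<and> kappa_bounded M act \<kappa> C
    \<and> (kappa_strictly_increasing M act \<kappa> \<alpha> \<longrightarrow>
        L0_upper_semicontinuous M C
        \<and> (\<forall>C'. certainty_equivalent M act \<kappa> \<alpha> C' \<longrightarrow>
              (\<forall>X. AE \<omega> in M. ereal (C' X \<omega>) = C X \<omega>)))"
proof -
  interpret usc_assessment_index M act K \<kappa> \<alpha> C
    using assms
    by (auto intro!: usc_assessment_index.intro assessment_index.intro
        usc_assessment_index_axioms.intro assessment_index_axioms.intro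
        locally_L0_convex_module.axioms(1))
  show ?thesis
    using C_finite CE_certainty_equivalent[unfolded CE_def[abs_def]] order_equivalent C_index
      C_sensitive C_bounded C_upper_semicontinuous certainty_equivalent_unique
    by blast
qed

end
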